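(* Let $X$ be a quasi-Borel space and let $\mu,\nu\in TX$. Then there exists a quasi-Borel space morphism $f\in\mathbf{Qbs}(X,T1)$, where $T1=[0,\infty]$, such that $\mu=\nu\triangleright f$, if and only if $\mu\stackrel{\infty}{\ll}\nu$.
   Context: A quasi-Borel space (qbs) is a set $X$ with a set $M_X$ of functions $\mathbb{R}\to X$ (random elements) such that: all constant functions are in $M_X$; $M_X$ is closed under precomposition with Borel measurable functions $\mathbb{R}\to\mathbb{R}$; and if $\mathbb{R}=\biguplus_{i\in\mathbb{N}}U_i$ with $U_i$ Borel and $\alpha_i\in M_X$, then the function equal to $\alpha_i$ on $U_i$ for each $i$ is in $M_X$. A morphism $f:X\to Y$ is a function with $f\circ\alpha\in M_Y$ for all $\alpha\in M_X$; $\mathbf{Qbs}(X,Y)$ is the set of morphisms. A measurable space $\Omega$ (e.g. a standard Borel space, or $[0,\infty]$) is regarded as a qbs with $M_\Omega$ the set of measurable functions $\mathbb{R}\to\Omega$. A qbs $X$ carries the $\sigma$-algebra $\Sigma_X=\{U\subseteq X\mid\forall\alpha\in M_X,\ \alpha^{-1}(U)\text{ is Borel}\}$; one has that $\mathbf{Qbs}(X,[0,\infty])$ is the set of $\Sigma_X$-measurable functions $X\to[0,\infty]$. A measure is s-finite if it is a countable sum of finite measures. The set $TX$ consists of triples $\langle\Omega,\mu,\alpha\rangle$, with $\Omega$ a standard Borel space, $\mu$ an s-finite measure on $\Omega$ and $\alpha\in\mathbf{Qbs}(\Omega,X)$, where two triples are identified when $\int_\Omega\mu(\mathrm{d}\omega)f(\alpha(\omega))=\int_{\Omega'}\mu'(\mathrm{d}\omega)f(\alpha'(\omega))$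 for all $f\in\mathbf{Qbs}(X,[0,\infty])$. The class of $\langle\Omega,\mu,\alpha\rangle$ is identified with the s-finite measure $\alpha_*\mu$ on $\Sigma_X$, so that $TX$ is a set of s-finite measures on $\Sigma_X$. For the one-point space $1$, $T1$ is identified with $[0,\infty]$ (as quasi-Borel spaces). For a measure $\nu$ on $\Sigma_X$ and measurable $f:X\to[0,\infty]$, $(\nu\triangleright f)(V)=\int_V\nu(\mathrm{d}x)f(x)$ (with $\infty\cdot0=0$). A set $U\in\Sigma_X$ is a $\nu$-$0$-$\infty$-set if every $V\in\Sigma_X$ with $V\subseteq U$ satisfies $\nu(V)\in\{0,\infty\}$. $\mu\stackrel{\infty}{\ll}\nu$ means that every $\nu$-null set is $\mu$-null and every $\nu$-$0$-$\infty$-set is a $\mu$-$0$-$\infty$-set. *)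

theory Defs
  imports "HOL-Analysis.Analysis"
begin

section \<open>Quasi-Borel spaces\<close>

record 'a qbs =
  points :: "'a set"
  randoms :: "(real \<Rightarrow> 'a) set"

definition quasi_borel_space :: "'a qbs \<Rightarrow> bool" where
  "quasi_borel_space X \<longleftrightarrow>
     randoms X \<subseteq> UNIV \<rightarrow> points X \<and>
     (\<forall>x\<in>points X. (\<lambda>_. x) \<in> randoms X) \<and>
     (\<forall>\<alpha>\<in>randoms X. \<forall>\<phi>\<in>borel_measurable borel. \<alpha> \<circ> \<phi> \<in> randoms X) \<and>
     (\<forall>(U :: nat \<Rightarrow> real set) \<alpha> \<beta>.
        (\<forall>i. U i \<in> sets borel) \<longrightarrow> disjoint_family U \<longrightarrow> (\<Union>i. U i) = UNIV \<longrightarrow>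
        (\<forall>i. \<alpha> i \<in> randoms X) \<longrightarrow> (\<forall>i. \<forall>r\<in>U i. \<beta> r = \<alpha> i r) \<longrightarrow>
        \<beta> \<in> randoms X)"

definition qbs_morphisms :: "'a qbs \<Rightarrow> 'b qbs \<Rightarrow> ('a \<Rightarrow> 'b) set" where
  "qbs_morphisms X Y =
     {f \<in> points X \<rightarrow> points Y. \<forall>\<alpha>\<in>randoms X. f \<circ> \<alpha> \<in> randoms Y}"

text \<open>A measurable space regarded as a quasi-Borel space; only the carrier and the
  \<open>\<sigma>\<close>-algebra of the argument matter, not its measure.\<close>

definition qbs_of :: "'a measure \<Rightarrow> 'a qbs" where
  "qbs_of \<Omega> = \<lparr>points = space \<Omega>, randoms = measurable borel \<Omega>\<rparr>"

definition qbs_sets :: "'a qbs \<Rightarrow> 'a set set" where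
  "qbs_sets X = {U. U \<subseteq> points X \<and> (\<forall>\<alpha>\<in>randoms X. \<alpha> -` U \<in> sets borel)}"

definition qbs_sigma :: "'a qbs \<Rightarrow> 'a measure" where
  "qbs_sigma X = sigma (points X) (qbs_sets X)"

lemma quasi_borel_space_qbs_of: "quasi_borel_space (qbs_of \<Omega>)"
proof -
  have glue: "\<beta> \<in> measurable borel \<Omega>"
    if U: "\<And>i. U i \<in> sets borel" and un: "(\<Union>i. U i) = UNIV"
      and \<alpha>: "\<And>i. \<alpha> i \<in> measurable borel \<Omega>"
      and eq: "\<And>i r. r \<in> U i \<Longrightarrow> \<beta> r = \<alpha> i r"
    for U :: "nat \<Rightarrow> real set" and \<alpha> \<beta>
  proof (rule measurableI)
    fix r :: real
    obtain i where "r \<in> U i" using un by blast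
    then show "\<beta> r \<in> space \<Omega>"
      using eq measurable_space[OF \<alpha>[of i], of r] by simp
  next
    fix A assume A: "A \<in> sets \<Omega>"
    have "\<beta> -` A \<inter> space borel = (\<Union>i. U i \<inter> (\<alpha> i -` A \<inter> space borel))"
    proof (intro set_eqI iffI)
      fix r assume "r \<in> \<beta> -` A \<inter> space borel"
      moreover obtain i where "r \<in> U i" using un by blast
      ultimately show "r \<in> (\<Union>i. U i \<inter> (\<alpha> i -` A \<inter> space borel))"
        using eq[of r i] by auto
    next
      fix r assume "r \<in> (\<Union>i. U i \<inter> (\<alpha> i -` A \<inter> space borel))"
      then show "r \<in> \<beta> -` A \<inter> space borel"
        using eq by auto
    qed
    also have "\<dots> \<in> sets borel"
      using U measurable_sets[OF \<alpha> A] by blast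
    finally show "\<beta> -` A \<inter> space borel \<in> sets borel" .
  qed
  show ?thesis
    unfolding quasi_borel_space_def
  proof (intro conjI ballI allI impI)
    show "randoms (qbs_of \<Omega>) \<subseteq> UNIV \<rightarrow> points (qbs_of \<Omega>)"
      by (auto simp: qbs_of_def measurable_def)
    show "(\<lambda>_. x) \<in> randoms (qbs_of \<Omega>)" if "x \<in> points (qbs_of \<Omega>)" for x
      using that by (simp add: qbs_of_def)
    show "\<alpha> \<circ> \<phi> \<in> randoms (qbs_of \<Omega>)"
      if "\<alpha> \<in> randoms (qbs_of \<Omega>)" "\<phi> \<in> borel_measurable borel" for \<alpha> \<phi>
      using measurable_comp[OF that(2), of \<alpha> \<Omega>] that(1) by (simp add: qbs_of_def)
    show "\<beta> \<in> randoms (qbs_of \<Omega>)"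
      if "\<forall>i. U i \<in> sets borel" "(\<Union>i. U i) = UNIV"
        "\<forall>i. \<alpha> i \<in> randoms (qbs_of \<Omega>)" "\<forall>i. \<forall>r\<in>U i. \<beta> r = \<alpha> i r"
      for U :: "nat \<Rightarrow> real set" and \<alpha> \<beta>
      using glue[of U \<alpha> \<beta>] that by (simp add: qbs_of_def)
  qed
qed

lemma
  assumes "quasi_borel_space X"
  shows space_qbs_sigma: "space (qbs_sigma X) = points X"
    and sets_qbs_sigma: "sets (qbs_sigma X) = qbs_sets X"
proof -
  have sub: "randoms X \<subseteq> UNIV \<rightarrow> points X"
    using assms by (simp add: quasi_borel_space_def)
  have r: "\<alpha> r \<in> points X" if "\<alpha> \<in> randoms X" for \<alpha> r
    using subsetD[OF sub that] by (simp add: Pi_iff)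
  have "sigma_algebra (points X) (qbs_sets X)"
    unfolding sigma_algebra_iff2
  proof (intro conjI ballI allI impI)
    show "qbs_sets X \<subseteq> Pow (points X)" by (auto simp: qbs_sets_def)
    show "{} \<in> qbs_sets X" by (simp add: qbs_sets_def)
    show "points X - s \<in> qbs_sets X" if s: "s \<in> qbs_sets X" for s
    proof -
      have "\<alpha> -` (points X - s) = UNIV - \<alpha> -` s" if "\<alpha> \<in> randoms X" for \<alpha>
        using r[OF that] by auto
      moreover have "UNIV - \<alpha> -` s \<in> sets borel" if "\<alpha> \<in> randoms X" for \<alpha>
        using s that by (auto simp: qbs_sets_def Compl_eq_Diff_UNIV[symmetric])
      ultimately show ?thesis by (auto simp: qbs_sets_def)
    qed
    show "(\<Union>i::nat. A i) \<in> qbs_sets X" if "range A \<subseteq> qbs_sets X" for A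
    proof -
      have A: "A i \<in> qbs_sets X" for i
        using that by blast
      have "\<alpha> -` (\<Union>i. A i) \<in> sets borel" if "\<alpha> \<in> randoms X" for \<alpha>
        unfolding vimage_UN using A that by (intro sets.countable_UN) (auto simp: qbs_sets_def)
      moreover have "(\<Union>i. A i) \<subseteq> points X"
        using A by (auto simp: qbs_sets_def)
      ultimately show ?thesis by (simp add: qbs_sets_def)
    qed
  qed
  then show "space (qbs_sigma X) = points X" "sets (qbs_sigma X) = qbs_sets X"
    by (simp_all add: qbs_sigma_def space_measure_of_conv sigma_algebra.sets_measure_of_eq)
qed

section \<open>The monad of s-finite measures\<close>

definition standard_borel :: "'w measure \<Rightarrow> bool" where
  "standard_borel \<Omega> \<longleftrightarrow>
     (\<exists>\<T>. completely_metrizable_space \<T> \<and> second_countable \<T> \<and>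
          space \<Omega> = topspace \<T> \<and> sets \<Omega> = sigma_sets (topspace \<T>) {U. openin \<T> U})"

definition s_finite :: "'w measure \<Rightarrow> bool" where
  "s_finite M \<longleftrightarrow>
     (\<exists>N :: nat \<Rightarrow> 'w measure.
        (\<forall>i. finite_measure (N i) \<and> sets (N i) = sets M) \<and>
        (\<forall>A\<in>sets M. emeasure M A = (\<Sum>i. emeasure (N i) A)))"

text \<open>The measures on \<open>qbs_sigma X\<close> that are pushforwards of a triple
  \<open>\<langle>\<Omega>, \<mu>, \<alpha>\<rangle>\<close>; the measure \<open>\<mu>\<close> carries its space \<open>\<Omega>\<close>. Two triples are equivalent
  iff their pushforwards agree, so these measures stand for the equivalence classes.
  A HOL definition cannot quantify over the type on which \<open>\<Omega>\<close> lives, hence the type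
  argument. Every standard Borel space is isomorphic to a Borel subset of the reals, so
  \<open>TYPE(real)\<close> yields all such measures.\<close>

definition qbs_T :: "'w itself \<Rightarrow> 'a qbs \<Rightarrow> 'a measure set" where
  "qbs_T TYPE('w) X =
     {distr \<mu> (qbs_sigma X) \<alpha> | (\<mu> :: 'w measure) \<alpha>.
        standard_borel \<mu> \<and> s_finite \<mu> \<and> \<alpha> \<in> qbs_morphisms (qbs_of \<mu>) X}"

section \<open>Absolute continuity\<close>

definition zero_infty_set :: "'a measure \<Rightarrow> 'a set \<Rightarrow> bool" where
  "zero_infty_set \<nu> U \<longleftrightarrow>
     U \<in> sets \<nu> \<and> (\<forall>V\<in>sets \<nu>. V \<subseteq> U \<longrightarrow> emeasure \<nu> V \<in> {0, \<infinity>})"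

definition infty_absolutely_continuous :: "'a measure \<Rightarrow> 'a measure \<Rightarrow> bool"
    (infix \<open>\<lless>\<^sup>\<infinity>\<close> 50) where
  "\<mu> \<lless>\<^sup>\<infinity> \<nu> \<longleftrightarrow>
     absolutely_continuous \<nu> \<mu> \<and> (\<forall>U. zero_infty_set \<nu> U \<longrightarrow> zero_infty_set \<mu> U)"

end

theory Submission
  imports Defs
begin

text \<open>Weighting the finite summands of two s-finite measures \<open>\<mu>\<close> and \<open>\<nu>\<close> gives one finite measure
  \<open>P\<close> that dominates all of them, so by the classical Radon--Nikodym theorem \<open>\<mu> = P \<triangleright> g\<close> and
  \<open>\<nu> = P \<triangleright> f\<close> with \<open>f, g\<close> valued in \<open>[0,\<infinity>]\<close>. The set where \<open>f = 0\<close> is \<open>\<nu>\<close>-null, and the set where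
  \<open>f = \<infinity>\<close> is a \<open>\<nu>\<close>-\<open>0\<close>-\<open>\<infinity>\<close>-set because \<open>P\<close> is finite; the hypothesis therefore forces \<open>g = 0\<close> on the
  former and \<open>g \<in> {0, \<infinity>}\<close> on the latter, \<open>P\<close>-almost everywhere. Hence \<open>g / f\<close>, replaced by \<open>g\<close>
  where \<open>f = \<infinity>\<close>, is a density of \<open>\<mu>\<close> with respect to \<open>\<nu>\<close>.\<close>

section \<open>Densities with respect to a common finite measure\<close>

text \<open>The weighted sum works because each weight \<open>w i\<close> is small enough to bound
  the mass of the \<open>i\<close>-th term by (1/2)^i, yet strictly positive, so that a null set of
  the sum is null for every summand. The 1 in the denominator guards against \<open>N i\<close>
  having mass 0.\<close>

lemma finite_dominating_measure:
  fixes N :: "nat \<Rightarrow> 'a measure"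
  assumes fin: "\<And>i. finite_measure (N i)" and sets_N: "\<And>i. sets (N i) = sets M"
  shows "\<exists>P. finite_measure P \<and> sets P = sets M \<and> (\<forall>i. absolutely_continuous P (N i))"
proof -
  define w where "w i = ennreal ((1/2) ^ i / (1 + measure (N i) (space M)))" for i
  define p where "p A = (\<Sum>i. w i * emeasure (N i) A)" for A
  define P where "P = measure_of (space M) (sets M) p"
  have sets_P: "sets P = sets M" and space_P: "space P = space M"
    by (simp_all add: P_def)
  have P: "emeasure P A = p A" if "A \<in> sets M" for A
    using that
  proof (intro emeasure_measure_of[OF P_def])
    show "positive (sets P) p"
      by (simp add: positive_def p_def)
    show "countably_additive (sets P) p"
    proof (intro countably_additiveI)
      fix A :: "nat \<Rightarrow> 'a set" assume "range A \<subseteq> sets P" and disj: "disjoint_family A"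
      then have A: "range A \<subseteq> sets (N i)" for i
        by (simp add: sets_N sets_P)
      \<comment> \<open>Reading the sum over \<open>i\<close> as an integral against counting
        measure turns the exchange of the two sums into monotone convergence.\<close>
      have "(\<Sum>j. p (A j)) = (\<Sum>j. \<integral>\<^sup>+i. w i * emeasure (N i) (A j) \<partial>count_space UNIV)"
        by (simp add: p_def nn_integral_count_space_nat)
      also have "\<dots> = (\<integral>\<^sup>+i. (\<Sum>j. w i * emeasure (N i) (A j)) \<partial>count_space UNIV)"
        by (rule nn_integral_suminf[symmetric]) simp
      also have "\<dots> = (\<integral>\<^sup>+i. w i * emeasure (N i) (\<Union>j. A j) \<partial>count_space UNIV)"
        using suminf_emeasure[OF A disj] by simp
      also have "\<dots> = p (\<Union>j. A j)"
        by (simp add: p_def nn_integral_count_space_nat)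
      finally show "(\<Sum>j. p (A j)) = p (\<Union>j. A j)" .
    qed
  qed (use sets.space_closed in \<open>auto simp: sets_P\<close>)
  have "p (space M) \<le> (\<Sum>i. ennreal ((1/2) ^ i))"
    unfolding p_def
  proof (intro suminf_le summableI allI)
    fix i
    have "w i * emeasure (N i) (space M)
      = ennreal ((1/2) ^ i / (1 + measure (N i) (space M)) * measure (N i) (space M))"
      unfolding w_def finite_measure.emeasure_eq_measure[OF fin] by (intro ennreal_mult[symmetric]) auto
    also have "\<dots> \<le> ennreal ((1/2) ^ i)"
    proof (intro ennreal_leI)
      have m: "measure (N i) (space M) / (1 + measure (N i) (space M)) \<le> 1"
        using measure_nonneg[of "N i" "space M"] by (subst divide_le_eq_1) linarith
      show "(1/2) ^ i / (1 + measure (N i) (space M)) * measure (N i) (space M) \<le> (1/2) ^ i"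
        using mult_left_mono[OF m, of "(1/2) ^ i"] by simp
    qed
    finally show "w i * emeasure (N i) (space M) \<le> ennreal ((1/2) ^ i)" .
  qed
  moreover have "(\<Sum>i. ennreal ((1/2) ^ i)) \<noteq> \<infinity>"
    unfolding infinity_ennreal_def by (intro ennreal_suminf_neq_top summable_geometric) auto
  ultimately have "p (space M) \<noteq> \<infinity>"
    unfolding infinity_ennreal_def by (metis top_unique)
  then have "finite_measure P"
    using P[OF sets.top] by (intro finite_measureI) (simp add: space_P)
  moreover have "absolutely_continuous P (N i)" for i
    unfolding absolutely_continuous_def
  proof
    fix A assume "A \<in> null_sets P"
    then have A: "A \<in> sets M" and "p A = 0"
      using P by (auto simp: null_sets_def sets_P)
    then have "w i * emeasure (N i) A = 0"
      unfolding p_def by (subst (asm) suminf_eq_zero_iff) (auto intro: summableI)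
    moreover have "0 < 1 + measure (N i) (space M)"
      by (simp add: add_pos_nonneg)
    then have "w i \<noteq> 0"
      by (simp add: w_def not_le)
    ultimately show "A \<in> null_sets (N i)"
      using A by (simp add: null_sets_def sets_N)
  qed
  ultimately show ?thesis
    using sets_P by blast
qed

text \<open>Each \<open>N i\<close> has a density by Radon--Nikodym, and monotone convergence lets
  the densities be added. Their sum may be \<infinity> on a set of positive
  \<open>P\<close>-measure; this is how measures that are not \<sigma>-finite are reached.\<close>

lemma density_of_countable_sum:
  fixes N :: "nat \<Rightarrow> 'a measure"
  assumes "finite_measure P" and sets_P: "sets P = sets M" and sets_N: "\<And>i. sets (N i) = sets M"
    and ac: "\<And>i. absolutely_continuous P (N i)"
    and sum: "\<And>A. A \<in> sets M \<Longrightarrow> emeasure M A = (\<Sum>i. emeasure (N i) A)"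
  shows "\<exists>f\<in>borel_measurable P. M = density P f"
proof -
  interpret P: finite_measure P by fact
  obtain f where f[measurable]: "\<And>i. f i \<in> borel_measurable P" and N: "\<And>i. density P (f i) = N i"
    using P.Radon_Nikodym[OF ac] sets_N sets_P by metis
  have "M = density P (\<lambda>x. \<Sum>i. f i x)"
  proof (rule measure_eqI)
    fix A assume A: "A \<in> sets M"
    then have [measurable]: "A \<in> sets P" by (simp add: sets_P)
    have "emeasure M A = (\<Sum>i. \<integral>\<^sup>+x. f i x * indicator A x \<partial>P)"
      by (simp add: sum[OF A] N[symmetric] emeasure_density)
    also have "\<dots> = (\<integral>\<^sup>+x. (\<Sum>i. f i x) * indicator A x \<partial>P)"
      by (subst nn_integral_suminf[symmetric]) auto
    finally show "emeasure M A = emeasure (density P (\<lambda>x. \<Sum>i. f i x)) A"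
      by (simp add: emeasure_density)
  qed (simp add: sets_P)
  then show ?thesis by (intro bexI) measurable
qed

lemma s_finite_common_density:
  assumes "s_finite \<mu>" "s_finite \<nu>" and sets_eq: "sets \<mu> = sets \<nu>"
  obtains P f g where "finite_measure P" "f \<in> borel_measurable P" "g \<in> borel_measurable P"
    "\<mu> = density P g" "\<nu> = density P f"
proof -
  obtain K where K: "\<And>i. finite_measure (K i)" "\<And>i. sets (K i) = sets \<mu>"
      "\<And>A. A \<in> sets \<mu> \<Longrightarrow> emeasure \<mu> A = (\<Sum>i. emeasure (K i) A)"
    using assms(1) unfolding s_finite_def by blast
  obtain L where L: "\<And>i. finite_measure (L i)" "\<And>i. sets (L i) = sets \<nu>"
      "\<And>A. A \<in> sets \<nu> \<Longrightarrow> emeasure \<nu> A = (\<Sum>i. emeasure (L i) A)"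
    using assms(2) unfolding s_finite_def by blast
  \<comment> \<open>Interleaving both families, with \<open>K\<close> at even and \<open>L\<close>
    at odd indices, yields a single \<open>P\<close> that dominates \<mu> and \<nu>
    together.\<close>
  define N where "N i = (if even i then K (i div 2) else L (i div 2))" for i
  have "finite_measure (N i)" "sets (N i) = sets \<nu>" for i
    using K L sets_eq by (simp_all add: N_def)
  then obtain P where P: "finite_measure P" "sets P = sets \<nu>" "\<And>i. absolutely_continuous P (N i)"
    using finite_dominating_measure[of N \<nu>] by auto
  have "absolutely_continuous P (K i)" "absolutely_continuous P (L i)" for i
    using P(3)[of "2 * i"] P(3)[of "2 * i + 1"] by (simp_all add: N_def)
  then obtain f g where "g \<in> borel_measurable P" "\<mu> = density P g"
      "f \<in> borel_measurable P" "\<nu> = density P f"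
    using density_of_countable_sum[of P \<mu> K] density_of_countable_sum[of P \<nu> L] P K L sets_eq
    by auto
  with P(1) show thesis by (intro that)
qed

section \<open>Existence of the density\<close>

lemma density_quotient:
  assumes "finite_measure P"
    and f[measurable]: "f \<in> borel_measurable P" and g[measurable]: "g \<in> borel_measurable P"
    and ac: "density P g \<lless>\<^sup>\<infinity> density P f"
  shows "\<exists>h\<in>borel_measurable P. density P g = density (density P f) h"
proof -
  interpret P: finite_measure P by fact
  define U where "U = {x \<in> space P. f x = \<infinity>}"
  have U[measurable]: "U \<in> sets P" by (simp add: U_def)
  have zero: "AE x in P. f x = 0 \<longrightarrow> g x = 0"
  proof -
    have "{x \<in> space P. f x = 0} \<in> null_sets (density P f)"
      by (subst null_sets_density_iff) auto
    then have "{x \<in> space P. f x = 0} \<in> null_sets (density P g)"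
      using ac unfolding infty_absolutely_continuous_def absolutely_continuous_def by blast
    then have "AE x in P. x \<in> {x \<in> space P. f x = 0} \<longrightarrow> g x = 0"
      by (simp add: null_sets_density_iff)
    then show ?thesis
      using AE_space by eventually_elim auto
  qed
  have "zero_infty_set (density P f) U"
    unfolding zero_infty_set_def
  proof (intro conjI ballI impI)
    fix V assume "V \<in> sets (density P f)" "V \<subseteq> U"
    then have V[measurable]: "V \<in> sets P" and "\<And>x. f x * indicator V x = \<infinity> * indicator V x"
      by (auto simp: U_def indicator_def)
    then have "emeasure (density P f) V = \<infinity> * emeasure P V"
      by (simp add: emeasure_density nn_integral_cmult_indicator)
    then show "emeasure (density P f) V \<in> {0, \<infinity>}"
      by (auto simp: ennreal_top_mult)
  qed simp
  then have U_g: "zero_infty_set (density P g) U"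
    using ac by (simp add: infty_absolutely_continuous_def)
  have infty: "AE x in P. f x = \<infinity> \<longrightarrow> g x = 0 \<or> g x = \<infinity>"
  proof -
    \<comment> \<open>Where \<open>g\<close> is bounded by \<open>n\<close>, finiteness of
      \<open>P\<close> keeps the \<open>g\<close>-weighted measure finite. Inside the
      0-\<infinity>-set \<open>U\<close> it must then be 0, so \<open>g\<close> vanishes there
      almost everywhere. Letting \<open>n\<close> range over all naturals excludes every finite
      nonzero value of \<open>g\<close> on \<open>U\<close>.\<close>
    have "AE x in P. x \<in> U \<and> g x \<le> of_nat n \<longrightarrow> g x = 0" for n
    proof -
      define W where "W = {x \<in> U. g x \<le> of_nat n}"
      have W[measurable]: "W \<in> sets P"
      proof -
        have "W = U \<inter> {x \<in> space P. g x \<le> of_nat n}"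
          by (auto simp: U_def W_def)
        then show ?thesis by simp
      qed
      have "emeasure (density P g) W \<le> (\<integral>\<^sup>+x. of_nat n * indicator W x \<partial>P)"
        by (simp add: emeasure_density) (intro nn_integral_mono, auto simp: indicator_def W_def)
      also have "\<dots> = of_nat n * emeasure P W"
        by (simp add: nn_integral_cmult_indicator)
      also have "\<dots> < \<infinity>"
        by (simp add: P.emeasure_eq_measure ennreal_mult_less_top of_nat_less_top)
      finally have "emeasure (density P g) W \<noteq> \<infinity>"
        by simp
      moreover have "W \<subseteq> U"
        by (auto simp: W_def)
      then have "emeasure (density P g) W \<in> {0, \<infinity>}"
        using U_g W unfolding zero_infty_set_def sets_density by blast
      ultimately have "emeasure (density P g) W = 0"
        by blast
      then have "W \<in> null_sets (density P g)"
        by (simp add: null_sets_def)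
      then show ?thesis
        by (simp add: null_sets_density_iff W_def)
    qed
    then have "AE x in P. \<forall>n. x \<in> U \<and> g x \<le> of_nat n \<longrightarrow> g x = 0"
      unfolding AE_all_countable by blast
    then show ?thesis
      using AE_space
    proof eventually_elim
      case (elim x)
      show ?case
      proof (cases "g x = \<infinity>")
        case False
        then have "g x < top"
          by (simp add: less_top[symmetric])
        then obtain n where "g x < of_nat n"
          using ennreal_Ex_less_of_nat by blast
        then have "g x \<le> of_nat n"
          by (rule less_imp_le)
        then show ?thesis
          using elim by (auto simp: U_def)
      qed simp
    qed
  qed
  \<comment> \<open>At \<open>f x = \<infinity>\<close> and \<open>g x = \<infinity>\<close> the
    quotient would be 0 and lose the mass, whereas \<open>g x\<close> itself satisfies \<infinity> *
    \<open>g x\<close> = \<open>g x\<close> for both values 0 and \<infinity>. At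
    \<open>f x = 0\<close> the product is 0 whatever the quotient, which agrees with
    \<open>g x = 0\<close>.\<close>
  define h where "h x = (if f x = \<infinity> then g x else g x / f x)" for x
  have h[measurable]: "h \<in> borel_measurable P"
    unfolding h_def by measurable
  have "AE x in P. g x = f x * h x"
    using zero infty
  proof eventually_elim
    case (elim x)
    consider "f x = 0" | "f x = \<infinity>" | "f x \<noteq> 0" "f x \<noteq> \<infinity>" by blast
    then show ?case
    proof cases
      case 3
      then have "f x * (g x / f x) = g x"
        by (simp add: ennreal_times_divide mult.commute[of "f x"] ennreal_mult_divide_eq)
      with 3 show ?thesis by (simp add: h_def)
    qed (use elim in \<open>auto simp: h_def\<close>)
  qed
  then have "density P g = density P (\<lambda>x. f x * h x)"
    by (intro density_cong) auto
  then show ?thesis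
    using h by (auto simp: density_density_eq)
qed

section \<open>Absolute continuity of a measure given by a density\<close>

text \<open>A measurable subset \<open>V\<close> of a 0-\<infinity>-set is the union of its part
  with \<open>f = 0\<close> and the sets \<open>W n\<close> where \<open>f\<close> is at least
  1/\<open>n\<close>. If some \<open>W n\<close> has infinite measure, the integral of
  \<open>f\<close> over \<open>V\<close> is at least \<infinity>/\<open>n\<close> = \<infinity>;
  otherwise all \<open>W n\<close> are null and the integral is 0.\<close>

lemma density_infty_absolutely_continuous:
  assumes f[measurable]: "f \<in> borel_measurable \<nu>"
  shows "density \<nu> f \<lless>\<^sup>\<infinity> \<nu>"
  unfolding infty_absolutely_continuous_def
proof (intro conjI allI impI absolutely_continuousI_density f)
  fix U assume U: "zero_infty_set \<nu> U"
  show "zero_infty_set (density \<nu> f) U"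
    unfolding zero_infty_set_def
  proof (intro conjI ballI impI)
    show "U \<in> sets (density \<nu> f)"
      using U by (simp add: zero_infty_set_def)
  next
    fix V assume "V \<in> sets (density \<nu> f)" "V \<subseteq> U"
    then have V[measurable]: "V \<in> sets \<nu>" by simp
    \<comment> \<open>The product form avoids dividing by \<open>n\<close>; in particular
      \<open>W 0\<close> is empty.\<close>
    define W where "W n = {x \<in> V. 1 \<le> of_nat n * f x}" for n
    have W[measurable]: "W n \<in> sets \<nu>" for n
    proof -
      have "W n = V \<inter> {x \<in> space \<nu>. 1 \<le> of_nat n * f x}"
        using sets.sets_into_space[OF V] by (auto simp: W_def)
      then show ?thesis by simp
    qed
    have "W n \<subseteq> U" for n
      using \<open>V \<subseteq> U\<close> by (auto simp: W_def)
    then have W_0_infty: "emeasure \<nu> (W n) \<in> {0, \<infinity>}" for n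
      using U W[of n] unfolding zero_infty_set_def by blast
    show "emeasure (density \<nu> f) V \<in> {0, \<infinity>}"
    proof (cases "\<exists>n. emeasure \<nu> (W n) = \<infinity>")
      case True
      then obtain n where n: "emeasure \<nu> (W n) = \<infinity>" ..
      have "\<infinity> = (\<integral>\<^sup>+x. indicator (W n) x \<partial>\<nu>)"
        by (simp add: n)
      also have "\<dots> \<le> (\<integral>\<^sup>+x. of_nat n * (f x * indicator V x) \<partial>\<nu>)"
        by (intro nn_integral_mono) (auto simp: W_def indicator_def)
      also have "\<dots> = of_nat n * emeasure (density \<nu> f) V"
        by (simp add: nn_integral_cmult emeasure_density)
      finally show ?thesis
        by (auto simp: top_unique ennreal_mult_eq_top_iff)
    next
      case False
      then have "W n \<in> null_sets \<nu>" for n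
        using W_0_infty[of n] by (auto simp: null_sets_def)
      then have "AE x in \<nu>. \<forall>n. x \<notin> W n"
        by (simp add: AE_all_countable AE_not_in)
      then have "AE x in \<nu>. x \<in> V \<longrightarrow> f x = 0"
      proof eventually_elim
        case (elim x)
        show ?case
        proof (intro impI, rule ccontr)
          assume "x \<in> V" "f x \<noteq> 0"
          \<comment> \<open>Archimedean property applied to 1 / \<open>f x\<close>, which is finite
            because \<open>f x\<close> is nonzero.\<close>
          have "\<exists>n. 1 \<le> of_nat n * f x"
          proof (cases "f x = \<infinity>")
            case True
            then show ?thesis by (intro exI[of _ 1]) simp
          next
            case False
            then have fin: "f x < top" by (simp add: less_top)
            have "1 / f x < top"
              using \<open>f x \<noteq> 0\<close> by (simp add: less_top[symmetric] ennreal_divide_eq_top_iff)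
            then obtain n where "1 / f x < of_nat n"
              using ennreal_Ex_less_of_nat by blast
            then show ?thesis
              using \<open>f x \<noteq> 0\<close> fin by (auto simp: divide_less_ennreal intro: less_imp_le)
          qed
          then show False
            using elim \<open>x \<in> V\<close> by (auto simp: W_def)
        qed
      qed
      then have "V \<in> null_sets (density \<nu> f)"
        by (simp add: null_sets_density_iff)
      then show ?thesis by (simp add: null_sets_def)
    qed
  qed
qed

section \<open>From quasi-Borel spaces to measurable spaces\<close>

text \<open>A non-measurable set has \<open>emeasure\<close> \<open>0\<close>, so \<open>distr\<close> along a map that is not measurable gives
  measure \<open>0\<close> to some set and to its complement: it is the zero measure.\<close>

lemma s_finite_distr:
  assumes "s_finite M" and \<alpha>: "\<alpha> \<in> space M \<rightarrow> space S"
  shows "s_finite (distr M S \<alpha>)"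
proof (cases "\<alpha> \<in> measurable M S")
  case True
  obtain N where N: "\<And>i. finite_measure (N i)" "\<And>i. sets (N i) = sets M"
      "\<And>A. A \<in> sets M \<Longrightarrow> emeasure M A = (\<Sum>i. emeasure (N i) A)"
    using assms(1) unfolding s_finite_def by blast
  have \<alpha>N: "\<alpha> \<in> measurable (N i) S" for i
    using True by (simp add: measurable_cong_sets[OF N(2) refl])
  show ?thesis
    unfolding s_finite_def
  proof (intro exI[of _ "\<lambda>i. distr (N i) S \<alpha>"] conjI allI ballI)
    fix A assume "A \<in> sets (distr M S \<alpha>)"
    then show "emeasure (distr M S \<alpha>) A = (\<Sum>i. emeasure (distr (N i) S \<alpha>) A)"
      using True \<alpha>N by (simp add: emeasure_distr N(3) sets_eq_imp_space_eq[OF N(2)])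
  qed (use \<alpha>N N in \<open>auto intro: finite_measure.finite_measure_distr\<close>)
next
  case False
  then obtain A where A: "A \<in> sets S" "\<alpha> -` A \<inter> space M \<notin> sets M"
    using \<alpha> by (auto simp: measurable_def)
  have "\<alpha> -` (space S - A) \<inter> space M = space M - \<alpha> -` A \<inter> space M"
    using \<alpha> by auto
  then have "\<alpha> -` (space S - A) \<inter> space M \<notin> sets M"
    using A(2) sets.Diff[OF sets.top, of "\<alpha> -` (space S - A) \<inter> space M" M]
    by (auto simp: double_diff)
  \<comment> \<open>Unfolding \<open>distr\<close> leaves either the default value 0 of
    \<open>measure_of\<close> or the \<open>emeasure\<close> of a nonmeasurable preimage, which is 0
    too.\<close>
  then have "emeasure (distr M S \<alpha>) A = 0" "emeasure (distr M S \<alpha>) (space S - A) = 0"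
    using A by (simp_all add: distr_def emeasure_measure_of_conv emeasure_notin_sets)
  then have "emeasure (distr M S \<alpha>) (A \<union> (space S - A)) = 0"
    using A(1) by (intro emeasure_Un_null_set[THEN trans]) (auto simp: null_sets_def)
  then have "emeasure (distr M S \<alpha>) (space S) = 0"
    using sets.sets_into_space[OF A(1)] by (simp add: Un_absorb1)
  then have "emeasure (distr M S \<alpha>) B = 0" if "B \<in> sets S" for B
    using emeasure_space[of "distr M S \<alpha>" B] by simp
  moreover have "finite_measure (null_measure S)"
    by (rule finite_measureI) simp
  ultimately show ?thesis
    unfolding s_finite_def by (intro exI[of _ "\<lambda>_. null_measure S"]) simp
qed

lemma qbs_T_D:
  assumes X: "quasi_borel_space X" and "\<mu> \<in> qbs_T TYPE('w) X"
  shows "s_finite \<mu>" "sets \<mu> = sets (qbs_sigma X)"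
proof -
  obtain M :: "'w measure" and \<alpha> where \<mu>: "\<mu> = distr M (qbs_sigma X) \<alpha>"
    and M: "s_finite M" "\<alpha> \<in> qbs_morphisms (qbs_of M) X"
    using assms(2) unfolding qbs_T_def by blast
  show "sets \<mu> = sets (qbs_sigma X)"
    by (simp add: \<mu>)
  have "\<alpha> \<in> space M \<rightarrow> space (qbs_sigma X)"
    using M(2) by (simp add: qbs_morphisms_def qbs_of_def space_qbs_sigma[OF X])
  then show "s_finite \<mu>"
    unfolding \<mu> by (rule s_finite_distr[OF M(1)])
qed

text \<open>\<Sigma>_X is the final \<sigma>-algebra for the random elements: a set belongs to it
  exactly when all its pullbacks along them are Borel. Measurability of \<open>f\<close> can
  therefore be tested on the composites of \<open>f\<close> with random elements, which is the
  morphism condition.\<close>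

lemma qbs_morphisms_qbs_of:
  assumes X: "quasi_borel_space X"
  shows "qbs_morphisms X (qbs_of \<Omega>) = measurable (qbs_sigma X) \<Omega>"
proof -
  have "randoms X \<subseteq> UNIV \<rightarrow> points X"
    using X by (simp add: quasi_borel_space_def)
  then have \<alpha>: "\<alpha> r \<in> points X" if "\<alpha> \<in> randoms X" for \<alpha> r
    using that by blast
  have "f \<circ> \<alpha> \<in> measurable borel \<Omega> \<longleftrightarrow> (\<forall>A\<in>sets \<Omega>. \<alpha> -` (f -` A \<inter> points X) \<in> sets borel)"
    if "f \<in> points X \<rightarrow> space \<Omega>" "\<alpha> \<in> randoms X" for f \<alpha>
  proof -
    have "\<alpha> -` (f -` A \<inter> points X) = (f \<circ> \<alpha>) -` A" for A
      using \<alpha>[OF that(2)] by auto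
    then show ?thesis
      using that(1) \<alpha>[OF that(2)] by (auto simp: measurable_def)
  qed
  then show ?thesis
    by (auto simp: qbs_morphisms_def qbs_of_def measurable_def[of "qbs_sigma X"]
        space_qbs_sigma[OF X] sets_qbs_sigma[OF X] qbs_sets_def)
qed

theorem theorem21:
  fixes X :: "'a qbs" and \<mu> \<nu> :: "'a measure"
  assumes "quasi_borel_space X"
    and "\<mu> \<in> qbs_T TYPE('w) X"
    and "\<nu> \<in> qbs_T TYPE('v) X"
  shows "(\<exists>f \<in> qbs_morphisms X (qbs_of (borel :: ennreal measure)). \<mu> = density \<nu> f)
           \<longleftrightarrow> \<mu> \<lless>\<^sup>\<infinity> \<nu>"
proof -
  note \<mu> = qbs_T_D[OF assms(1,2)] and \<nu> = qbs_T_D[OF assms(1,3)]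
  \<comment> \<open>The morphisms into [0,\<infinity>] are precisely the candidate densities over
    \<nu>, so the claim becomes one about s-finite measures on a single \<sigma>-algebra.\<close>
  have mor: "qbs_morphisms X (qbs_of borel) = (borel_measurable \<nu> :: ('a \<Rightarrow> ennreal) set)"
    by (simp add: qbs_morphisms_qbs_of[OF assms(1)] measurable_cong_sets[OF \<nu>(2) refl])
  show ?thesis
    unfolding mor
  proof
    assume "\<exists>f\<in>borel_measurable \<nu>. \<mu> = density \<nu> f"
    then show "\<mu> \<lless>\<^sup>\<infinity> \<nu>"
      by (auto intro: density_infty_absolutely_continuous)
  next
    assume ac: "\<mu> \<lless>\<^sup>\<infinity> \<nu>"
    obtain P f g where P: "finite_measure P" "f \<in> borel_measurable P" "g \<in> borel_measurable P"
      "\<mu> = density P g" "\<nu> = density P f"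
      using s_finite_common_density[OF \<mu>(1) \<nu>(1)] \<mu>(2) \<nu>(2) by metis
    then show "\<exists>f\<in>borel_measurable \<nu>. \<mu> = density \<nu> f"
      using density_quotient[OF P(1-3)] ac by auto
  qed
qed

end
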